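(* Fix $T>0$ and consider the Gaussian feedback channel over $[0,T]$ $$Y(t)=\int_0^t g(s,M,Y_0^s)\,ds+B(t),\qquad t\in[0,T].$$ For each $n\in\mathbb{N}$ let $\Delta_n=\{t^{(n)}_0,t^{(n)}_1,\dots,t^{(n)}_n\}$ with $0=t^{(n)}_0<t^{(n)}_1<\dots<t^{(n)}_n=T$, let $\delta_{\Delta_n}=\max_{1\le i\le n}(t^{(n)}_i-t^{(n)}_{i-1})$, and let $Y(\Delta_n)=\{Y(t^{(n)}_0),Y(t^{(n)}_1),\dots,Y(t^{(n)}_n)\}$. 1) Assume: (a) the solution $\{Y(t)\}$ of the stochastic differential equation $Y(t)=\int_0^t g(s,M,Y_0^s)\,ds+B(t)$, $t\in[0,T]$, uniquely exists; (b) $\mathbb{P}\left(\int_0^T g^2(t,M,Y_0^t)\,dt<\infty\right)=\mathbb{P}\left(\int_0^T g^2(t,M,B_0^t)\,dt<\infty\right)=1$; (c) $\int_0^T\mathbb{E}[|g(t,M,Y_0^t)|]\,dt<\infty$. Suppose that $\Delta_n\subset\Delta_{n+1}$ for all $n$ and that $\delta_{\Delta_n}\to0$ as $n\to\infty$. Then $$\lim_{n\to\infty}I(M;Y(\Delta_n))=I(M;Y_0^T).$$ 2) Assume: (d) there exists a constant $L>0$ such that for all $0\le s_1,s_2,t_1,t_2\le T$, all $m\in\mathcal{M}$ and all $\varphi,\psi\in C[0,T]$, $|g(s_1,m,\varphi_0^{s_2})-g(t_1,m,\psi_0^{t_2})|\le L\left(|s_1-t_1|+\|\varphi_0^{s_2}-\psi_0^{t_2}\|\right)$;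 (e) there exists a constant $L>0$ such that for all $t\in[0,T]$, all $m\in\mathcal{M}$ and all $\varphi\in C[0,T]$, $|g(t,m,\varphi_0^t)|\le L(1+\|\varphi_0^t\|)$. Suppose that $\delta_{\Delta_n}\to0$ as $n\to\infty$ (the $\Delta_n$ need not be nested). Then $$\lim_{n\to\infty}I(M;Y(\Delta_n))=I(M;Y_0^T).$$
   Context: $(\Omega,\mathcal{F},\mathbb{P})$ is a probability space with a filtration satisfying the usual conditions and carrying a standard Brownian motion $\{B(t)\}$. $M$ (the message) is a random variable taking values in a finite alphabet $\mathcal{M}$, independent of $B$. $g$ is a real-valued deterministic (measurable) function; $g(s,m,\varphi_0^t)$ depends on the time $s\in[0,T]$, on $m\in\mathcal{M}$, and on the continuous path $\varphi_0^t=\{\varphi(r):0\le r\le t\}$, which is identified with the stopped path $r\mapsto\varphi(r\wedge t)$ (so $s$ and $t$ may differ). The output $Y$ starts at $Y(0)=0$, and $Y_0^s=\{Y(r):0\le r\le s\}$ (similarly $B_0^s$). Norms: $\|\varphi_0^t\|=\sup_{0\le r\le t}|\varphi(r)|$, and $\|\varphi_0^s-\psi_0^t\|=\sup_{r}|\varphi(r\wedge s)-\psi(r\wedge t)|$. $I(X;Z)$ denotes mutual information of general random elements (possibly vector- or path-valued): the supremum over finite partitions $\xi=\{A_i\}$ from $\sigma(X)$ and $\zeta=\{B_j\}$ from $\sigma(Z)$ of $\sum_{i,j}\mathbb{P}(A_i\cap B_j)\log\frac{\mathbb{P}(A_i\cap B_j)}{\mathbb{P}(A_i)\mathbb{P}(B_j)}$;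 equivalently $\mathbb{E}\left[\log\frac{d\mu_{X,Z}}{d(\mu_X\times\mu_Z)}(X,Z)\right]$ if this Radon–Nikodym derivative exists and $\infty$ otherwise. In $I(M;Y_0^T)$, $Y_0^T$ is regarded as a $C[0,T]$-valued random element. *)

theory Defs
  imports "HOL-Probability.Probability"
begin

section \<open>Mutual information of general random elements\<close>

definition finite_partitions_in :: "'a measure \<Rightarrow> 'a set set set" where
  "finite_partitions_in N = {\<xi>. finite \<xi> \<and> partition_on (space N) \<xi> \<and> \<xi> \<subseteq> sets N}"

text \<open>
  The library constant \<open>mutual_information\<close> is a real-valued Bochner integral, hence
  \<open>0\<close> where the true value is infinite. The supremum over finite partitions
  is used instead, with values in \<^typ>\<open>ereal\<close> and natural logarithm. Summands with
  probability \<open>0\<close> vanish, as the convention \<open>0 log 0 = 0\<close> demands.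
\<close>

definition general_mutual_info ::
  "'a measure \<Rightarrow> 'b measure \<Rightarrow> ('a \<Rightarrow> 'b) \<Rightarrow> 'c measure \<Rightarrow> ('a \<Rightarrow> 'c) \<Rightarrow> ereal" where
  "general_mutual_info P S X U Z =
    (SUP (\<xi>, \<zeta>) \<in> finite_partitions_in (vimage_algebra (space P) X S)
                \<times> finite_partitions_in (vimage_algebra (space P) Z U).
       ereal (\<Sum>A\<in>\<xi>. \<Sum>B\<in>\<zeta>. measure P (A \<inter> B) *
                ln (measure P (A \<inter> B) / (measure P A * measure P B))))"

section \<open>Path space\<close>

text \<open>
  \<open>C[0,T]\<close>: continuous functions on \<open>[0,T]\<close>, extended by \<^const>\<open>undefined\<close>
  outside. The cylinder \<open>\<sigma>\<close>-algebra is the Borel \<open>\<sigma>\<close>-algebra of the uniform norm.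
\<close>

definition path_space :: "real \<Rightarrow> (real \<Rightarrow> real) measure" where
  "path_space T = restrict_space (Pi\<^sub>M {0..T} (\<lambda>_. borel)) {\<phi>. continuous_on {0..T} \<phi>}"

definition path_of :: "real \<Rightarrow> (real \<Rightarrow> 'a \<Rightarrow> real) \<Rightarrow> 'a \<Rightarrow> real \<Rightarrow> real" where
  "path_of T Z \<omega> = (\<lambda>r\<in>{0..T}. Z r \<omega>)"

text \<open>The path \<open>\<phi>\<^sub>0\<^sup>t\<close>, as the stopped path \<open>r \<mapsto> \<phi>(r \<and> t)\<close> in \<open>C[0,T]\<close>.\<close>

definition stopped :: "real \<Rightarrow> real \<Rightarrow> (real \<Rightarrow> real) \<Rightarrow> real \<Rightarrow> real" where
  "stopped T t \<phi> = (\<lambda>r\<in>{0..T}. \<phi> (min r t))"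

definition path_norm :: "real \<Rightarrow> (real \<Rightarrow> real) \<Rightarrow> real" where
  "path_norm t \<phi> = (SUP r\<in>{0..t}. \<bar>\<phi> r\<bar>)"

definition path_dist :: "real \<Rightarrow> real \<Rightarrow> (real \<Rightarrow> real) \<Rightarrow> real \<Rightarrow> (real \<Rightarrow> real) \<Rightarrow> real" where
  "path_dist T s \<phi> t \<psi> = (SUP r\<in>{0..T}. \<bar>\<phi> (min r s) - \<psi> (min r t)\<bar>)"

section \<open>Filtration and Brownian motion\<close>

text \<open>Time runs over \<open>[0,\<infinity>)\<close>; nothing is required at negative times.\<close>

definition usual_filtration :: "'a measure \<Rightarrow> (real \<Rightarrow> 'a measure) \<Rightarrow> bool" where
  "usual_filtration P F \<longleftrightarrow>
     (\<forall>t\<ge>0. subalgebra P (F t)) \<and>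
     (\<forall>s t. 0 \<le> s \<longrightarrow> s \<le> t \<longrightarrow> sets (F s) \<subseteq> sets (F t)) \<and>
     (\<forall>t\<ge>0. sets (F t) = (\<Inter>s\<in>{t<..}. sets (F s))) \<and>
     (\<forall>N\<in>null_sets P. \<forall>A. A \<subseteq> N \<longrightarrow> A \<in> sets (F 0))"

definition standard_brownian_motion ::
  "'a measure \<Rightarrow> (real \<Rightarrow> 'a measure) \<Rightarrow> (real \<Rightarrow> 'a \<Rightarrow> real) \<Rightarrow> bool" where
  "standard_brownian_motion P F B \<longleftrightarrow>
     (\<forall>t\<ge>0. B t \<in> borel_measurable (F t)) \<and>
     (\<forall>\<omega>\<in>space P. continuous_on {0..} (\<lambda>t. B t \<omega>)) \<and>
     (AE \<omega> in P. B 0 \<omega> = 0) \<and>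
     (\<forall>s t. 0 \<le> s \<longrightarrow> s < t \<longrightarrow>
        distributed P lborel (\<lambda>\<omega>. B t \<omega> - B s \<omega>) (normal_density 0 (sqrt (t - s))) \<and>
        prob_space.indep_set P (sets (F s))
          (sets (vimage_algebra (space P) (\<lambda>\<omega>. B t \<omega> - B s \<omega>) borel)))"

section \<open>The feedback channel\<close>

text \<open>The drift \<open>g(s,M,Z\<^sub>0\<^sup>s)\<close> along a process \<open>Z\<close>.\<close>

definition drift ::
  "(real \<Rightarrow> 'm \<Rightarrow> (real \<Rightarrow> real) \<Rightarrow> real) \<Rightarrow> real \<Rightarrow> ('a \<Rightarrow> 'm) \<Rightarrow> (real \<Rightarrow> 'a \<Rightarrow> real)
    \<Rightarrow> real \<Rightarrow> 'a \<Rightarrow> real" where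
  "drift g T M Z s \<omega> = g s (M \<omega>) (stopped T s (\<lambda>r. Z r \<omega>))"

text \<open>The filtration generated by the message and the noise, augmented by the null sets.\<close>

definition channel_filtration ::
  "'a measure \<Rightarrow> 'm set \<Rightarrow> ('a \<Rightarrow> 'm) \<Rightarrow> (real \<Rightarrow> 'a \<Rightarrow> real) \<Rightarrow> real \<Rightarrow> 'a measure" where
  "channel_filtration P \<M> M B t =
     sigma (space P)
       (sets (vimage_algebra (space P) M (count_space \<M>)) \<union>
        (\<Union>s\<in>{0..t}. sets (vimage_algebra (space P) (B s) borel)) \<union>
        null_sets P)"

text \<open>
  Strong solution on the given space, for the given noise and message: the integral equation
  holds almost surely, simultaneously for all times. Integrability of the drift is required
  since a divergent Bochner integral would be \<open>0\<close>.
\<close>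

definition channel_solution ::
  "'a measure \<Rightarrow> (real \<Rightarrow> 'a \<Rightarrow> real) \<Rightarrow> 'm set \<Rightarrow> ('a \<Rightarrow> 'm)
    \<Rightarrow> (real \<Rightarrow> 'm \<Rightarrow> (real \<Rightarrow> real) \<Rightarrow> real) \<Rightarrow> real \<Rightarrow> (real \<Rightarrow> 'a \<Rightarrow> real) \<Rightarrow> bool" where
  "channel_solution P B \<M> M g T Y \<longleftrightarrow>
     (\<forall>t\<in>{0..T}. Y t \<in> borel_measurable (channel_filtration P \<M> M B t)) \<and>
     (\<forall>\<omega>\<in>space P. continuous_on {0..T} (\<lambda>t. Y t \<omega>)) \<and>
     (AE \<omega> in P. set_integrable lborel {0..T} (\<lambda>s. drift g T M Y s \<omega>) \<and>
        (\<forall>t\<in>{0..T}. Y t \<omega> = (LBINT s:{0..t}. drift g T M Y s \<omega>) + B t \<omega>))"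

text \<open>\<open>Y\<close> is the solution, unique up to indistinguishability.\<close>

definition unique_channel_solution ::
  "'a measure \<Rightarrow> (real \<Rightarrow> 'a \<Rightarrow> real) \<Rightarrow> 'm set \<Rightarrow> ('a \<Rightarrow> 'm)
    \<Rightarrow> (real \<Rightarrow> 'm \<Rightarrow> (real \<Rightarrow> real) \<Rightarrow> real) \<Rightarrow> real \<Rightarrow> (real \<Rightarrow> 'a \<Rightarrow> real) \<Rightarrow> bool" where
  "unique_channel_solution P B \<M> M g T Y \<longleftrightarrow>
     channel_solution P B \<M> M g T Y \<and>
     (\<forall>Y'. channel_solution P B \<M> M g T Y' \<longrightarrow>
        (AE \<omega> in P. \<forall>t\<in>{0..T}. Y' t \<omega> = Y t \<omega>))"

section \<open>Sampling times\<close>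

definition sampling_times :: "real \<Rightarrow> nat \<Rightarrow> (nat \<Rightarrow> real) \<Rightarrow> bool" where
  "sampling_times T n \<tau> \<longleftrightarrow> \<tau> 0 = 0 \<and> \<tau> n = T \<and> (\<forall>i<n. \<tau> i < \<tau> (Suc i))"

definition mesh :: "nat \<Rightarrow> (nat \<Rightarrow> real) \<Rightarrow> real" where
  "mesh n \<tau> = (MAX i\<in>{1..n}. \<tau> i - \<tau> (i - 1))"

definition sampled :: "nat \<Rightarrow> (nat \<Rightarrow> real) \<Rightarrow> (real \<Rightarrow> 'a \<Rightarrow> real) \<Rightarrow> 'a \<Rightarrow> nat \<Rightarrow> real" where
  "sampled n \<tau> Y \<omega> = (\<lambda>i\<in>{0..n}. Y (\<tau> i) \<omega>)"

definition sampled_mutual_info ::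
  "'a measure \<Rightarrow> 'm set \<Rightarrow> ('a \<Rightarrow> 'm) \<Rightarrow> (real \<Rightarrow> 'a \<Rightarrow> real) \<Rightarrow> nat \<Rightarrow> (nat \<Rightarrow> real) \<Rightarrow> ereal" where
  "sampled_mutual_info P \<M> M Y n \<tau> =
     general_mutual_info P (count_space \<M>) M (Pi\<^sub>M {0..n} (\<lambda>_. borel)) (sampled n \<tau> Y)"

definition path_mutual_info ::
  "'a measure \<Rightarrow> 'm set \<Rightarrow> ('a \<Rightarrow> 'm) \<Rightarrow> (real \<Rightarrow> 'a \<Rightarrow> real) \<Rightarrow> real \<Rightarrow> ereal" where
  "path_mutual_info P \<M> M Y T =
     general_mutual_info P (count_space \<M>) M (path_space T) (path_of T Y)"

end

(*
  Mutual information is a supremum over finite partitions, and each term depends continuously on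
  the partition for the pseudo-metric P (A \<triangle> B) on events. The events that can be approximated in
  this pseudo-metric by events of the sampled sigma-algebras, as the mesh tends to 0, form a
  sigma-algebra. Path continuity puts {Y r > a} into it, hence it contains every event of the full
  path. Neither nestedness of the grids nor a Girsanov density is involved, so both parts of the
  theorem have the same proof.
*)
theory Submission
  imports Defs "HOL-Real_Asymp.Real_Asymp"
begin

section \<open>Events approximable by a sequence of sigma-algebras\<close>

text \<open>Dominated convergence for the indicators, with the constant 1 as bound, integrable
  because the measure is finite. It serves both for events shrinking to the empty set and for
  passing from pointwise convergence to convergence in measure.\<close>

lemma (in finite_measure) measure_tendsto_0_of_eventually_notin:
  assumes E: "\<And>n. E n \<in> sets M"
    and ev: "\<And>\<omega>. \<omega> \<in> space M \<Longrightarrow> \<forall>\<^sub>F n in sequentially. \<omega> \<notin> E n"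
  shows "(\<lambda>n. measure M (E n)) \<longlonglongrightarrow> 0"
proof -
  have "(\<lambda>n. \<integral>\<omega>. indicator (E n) \<omega> \<partial>M) \<longlonglongrightarrow> (\<integral>\<omega>. (0 :: real) \<partial>M)"
  proof (rule integral_dominated_convergence[where w = "\<lambda>_. 1"])
    show "AE \<omega> in M. (\<lambda>n. indicator (E n) \<omega> :: real) \<longlonglongrightarrow> 0"
    proof (rule AE_I2)
      fix \<omega> assume "\<omega> \<in> space M"
      from ev[OF this] show "(\<lambda>n. indicator (E n) \<omega> :: real) \<longlonglongrightarrow> 0"
        by (intro tendsto_eventually) (auto elim: eventually_mono)
    qed
  qed (use E in \<open>auto simp: indicator_def\<close>)
  then show ?thesis
    using E sets.sets_into_space by (simp add: Int_absorb2)
qed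

text \<open>The distance from \<open>A\<close> to \<open>sets (G n)\<close> in the pseudo-metric
  \<open>measure P (sym_diff A S)\<close> tends to 0. The approximation is asked for eventually, not
  just for some \<open>n\<close>: for \<open>G\<close> that need not increase, an approximant found
  at one stage may be lost at the next.\<close>

definition approximable :: "'a measure \<Rightarrow> (nat \<Rightarrow> 'a measure) \<Rightarrow> 'a set \<Rightarrow> bool" where
  "approximable P G A \<longleftrightarrow> A \<in> sets P \<and>
     (\<forall>e>0. \<forall>\<^sub>F n in sequentially. \<exists>S\<in>sets (G n). measure P (sym_diff A S) < e)"

lemma approximable_empty: "approximable P G {}"
  unfolding approximable_def by (auto intro!: always_eventually bexI[of _ "{}"])

text \<open>At stage \<open>n\<close>, pick an event whose distance to \<open>A\<close> exceeds the
  infimum over \<open>sets (G n)\<close> by less than \<open>1 / Suc n\<close>; the infimum itself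
  may not be attained. This one sequence then works for every \<open>e\<close>.\<close>

lemma (in finite_measure) approximable_sequence:
  assumes "approximable M G A"
  obtains S where "\<And>n. S n \<in> sets (G n)" "(\<lambda>n. measure M (sym_diff A (S n))) \<longlonglongrightarrow> 0"
proof -
  let ?d = "\<lambda>S. measure M (sym_diff A S)"
  let ?i = "\<lambda>n. INF S\<in>sets (G n). ?d S"
  have bdd: "bdd_below (?d ` sets (G n))" for n
    by (rule bdd_belowI2[of _ 0]) simp
  have "\<exists>S\<in>sets (G n). ?d S < ?i n + 1 / Suc n" for n
    by (rule cINF_less_iff[THEN iffD1, OF _ bdd]) auto
  then obtain S where S: "\<And>n. S n \<in> sets (G n)" "\<And>n. ?d (S n) < ?i n + 1 / Suc n"
    by metis
  have "(\<lambda>n. ?d (S n)) \<longlonglongrightarrow> 0"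
  proof (rule LIMSEQ_I)
    fix r :: real assume r: "0 < r"
    have "\<forall>\<^sub>F n in sequentially. \<exists>S\<in>sets (G n). ?d S < r / 2"
      using assms r unfolding approximable_def by (meson half_gt_zero)
    moreover have "\<forall>\<^sub>F n in sequentially. 1 / real (Suc n) < r / 2"
      using order_tendstoD(2)[OF LIMSEQ_inverse_real_of_nat, of "r / 2"] r
      by (simp add: inverse_eq_divide)
    ultimately have "\<forall>\<^sub>F n in sequentially. norm (?d (S n) - 0) < r"
    proof eventually_elim
      case (elim n)
      then obtain S' where "S' \<in> sets (G n)" "?d S' < r / 2" by blast
      then have "?i n < r / 2"
        by (intro order.strict_trans1[OF cINF_lower[OF bdd]])
      with S(2)[of n] elim(2) show ?case by simp
    qed
    then show "\<exists>N. \<forall>n\<ge>N. norm (?d (S n) - 0) < r"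
      by (simp add: eventually_sequentially)
  qed
  then show thesis by (rule that[OF S(1)])
qed

text \<open>Triangle inequality for the pseudo-metric: \<open>A'\<close> is within
  \<open>e / 2\<close> of \<open>A\<close>, and an approximant of \<open>A'\<close> within another
  \<open>e / 2\<close>. This carries finite unions over to countable ones.\<close>

lemma (in finite_measure) approximable_closed:
  assumes G: "\<And>n. sets (G n) \<subseteq> sets M" and A: "A \<in> sets M"
    and near: "\<And>e. 0 < e \<Longrightarrow> \<exists>A'. approximable M G A' \<and> measure M (sym_diff A A') < e"
  shows "approximable M G A"
  unfolding approximable_def
proof (intro conjI A allI impI)
  fix e :: real assume "0 < e"
  then obtain A' where A': "approximable M G A'" "measure M (sym_diff A A') < e / 2"
    using near[of "e / 2"] by auto
  have "\<forall>\<^sub>F n in sequentially. \<exists>S\<in>sets (G n). measure M (sym_diff A' S) < e / 2"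
    using A'(1) \<open>0 < e\<close> unfolding approximable_def by (meson half_gt_zero)
  then show "\<forall>\<^sub>F n in sequentially. \<exists>S\<in>sets (G n). measure M (sym_diff A S) < e"
  proof eventually_elim
    case (elim n)
    then obtain S where S: "S \<in> sets (G n)" "measure M (sym_diff A' S) < e / 2" by blast
    have [measurable]: "S \<in> sets M" "A \<in> sets M" "A' \<in> sets M"
      using S G A A'(1) by (auto simp: approximable_def)
    have "measure M (sym_diff A S) \<le> measure M (sym_diff A A' \<union> sym_diff A' S)"
      by (rule finite_measure_mono) auto
    also have "\<dots> \<le> measure M (sym_diff A A') + measure M (sym_diff A' S)"
      by (rule measure_Un_le) auto
    finally show ?case using S A'(2) by force
  qed
qed

lemma (in finite_measure) approximable_Un:
  assumes G: "\<And>n. sets (G n) \<subseteq> sets M" and A: "approximable M G A" and B: "approximable M G B"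
  shows "approximable M G (A \<union> B)"
  unfolding approximable_def
proof (intro conjI allI impI)
  show "A \<union> B \<in> sets M" using A B by (auto simp: approximable_def)
  fix e :: real assume "0 < e"
  then have "\<forall>\<^sub>F n in sequentially. \<exists>S\<in>sets (G n). measure M (sym_diff A S) < e / 2"
    "\<forall>\<^sub>F n in sequentially. \<exists>S\<in>sets (G n). measure M (sym_diff B S) < e / 2"
    using A B unfolding approximable_def by (meson half_gt_zero)+
  then show "\<forall>\<^sub>F n in sequentially. \<exists>S\<in>sets (G n). measure M (sym_diff (A \<union> B) S) < e"
  proof eventually_elim
    case (elim n)
    then obtain S R where S: "S \<in> sets (G n)" "measure M (sym_diff A S) < e / 2"
      and R: "R \<in> sets (G n)" "measure M (sym_diff B R) < e / 2" by blast
    have [measurable]: "S \<in> sets M" "R \<in> sets M" "A \<in> sets M" "B \<in> sets M"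
      using S R G A B by (auto simp: approximable_def)
    have "measure M (sym_diff (A \<union> B) (S \<union> R)) \<le> measure M (sym_diff A S \<union> sym_diff B R)"
      by (rule finite_measure_mono) auto
    also have "\<dots> \<le> measure M (sym_diff A S) + measure M (sym_diff B R)"
      by (rule measure_Un_le) auto
    finally show ?case using S R by (intro bexI[of _ "S \<union> R"]) auto
  qed
qed

text \<open>Complementing both events leaves their symmetric difference unchanged. A countable union
  is the limit of its partial unions in the pseudo-metric, so finite unions and closedness
  suffice.\<close>

lemma (in finite_measure) sigma_algebra_approximable:
  assumes G: "\<And>n. sets (G n) \<subseteq> sets M" and sp: "\<And>n. space (G n) = space M"
  shows "sigma_algebra (space M) {A. approximable M G A}"
  unfolding sigma_algebra_iff2
proof (intro conjI ballI allI impI)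
  show "{A. approximable M G A} \<subseteq> Pow (space M)"
    using sets.sets_into_space by (auto simp: approximable_def)
  show "{} \<in> {A. approximable M G A}" by (simp add: approximable_empty)
  fix A assume A: "A \<in> {A. approximable M G A}"
  show "space M - A \<in> {A. approximable M G A}"
    unfolding mem_Collect_eq approximable_def
  proof (intro conjI allI impI)
    show "space M - A \<in> sets M" using A by (auto simp: approximable_def)
    fix e :: real assume "0 < e"
    then have "\<forall>\<^sub>F n in sequentially. \<exists>S\<in>sets (G n). measure M (sym_diff A S) < e"
      using A by (auto simp: approximable_def)
    then show "\<forall>\<^sub>F n in sequentially. \<exists>S\<in>sets (G n). measure M (sym_diff (space M - A) S) < e"
    proof eventually_elim
      case (elim n)
      then obtain S where S: "S \<in> sets (G n)" "measure M (sym_diff A S) < e" by blast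
      have "A \<subseteq> space M" "S \<subseteq> space M"
        using A S(1) sets.sets_into_space[of A M] sets.sets_into_space[of S "G n"] sp
        by (auto simp: approximable_def)
      then have "sym_diff (space M - A) (space M - S) = sym_diff A S" by blast
      moreover have "space M - S \<in> sets (G n)"
        using S(1) sp by (metis sets.compl_sets)
      ultimately show ?case using S(2) by metis
    qed
  qed
next
  fix A :: "nat \<Rightarrow> 'a set" assume A: "range A \<subseteq> {A. approximable M G A}"
  let ?U = "\<lambda>k. \<Union>i<k. A i"
  have app: "approximable M G (?U k)" for k
  proof (induction k)
    case 0
    show ?case by (simp add: approximable_empty)
  next
    case (Suc k)
    have "?U (Suc k) = ?U k \<union> A k" by (auto simp: less_Suc_eq)
    moreover have "approximable M G (A k)" using A by auto
    ultimately show ?case using approximable_Un[of G, OF G Suc] by simp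
  qed
  have [measurable]: "A i \<in> sets M" for i using A by (auto simp: approximable_def)
  \<comment> \<open>A point of the union lies in some \<open>A i\<close>, hence in
    \<open>?U k\<close> for all \<open>k > i\<close>.\<close>
  have lim: "(\<lambda>k. measure M ((\<Union>i. A i) - ?U k)) \<longlonglongrightarrow> 0"
  proof (rule measure_tendsto_0_of_eventually_notin)
    fix \<omega>
    show "\<forall>\<^sub>F k in sequentially. \<omega> \<notin> (\<Union>i. A i) - ?U k"
    proof (cases "\<exists>i. \<omega> \<in> A i")
      case True
      then obtain i where "\<omega> \<in> A i" ..
      then have "\<omega> \<notin> (\<Union>i. A i) - ?U k" if "i < k" for k using that by blast
      with eventually_gt_at_top[of i] show ?thesis by (rule eventually_mono)
    qed auto
  qed auto
  have "approximable M G (\<Union>i. A i)"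
  proof (rule approximable_closed[OF G])
    fix e :: real assume "0 < e"
    with order_tendstoD(2)[OF lim] obtain k where "measure M ((\<Union>i. A i) - ?U k) < e"
      by (auto simp: eventually_sequentially)
    moreover have "sym_diff (\<Union>i. A i) (?U k) = (\<Union>i. A i) - ?U k" by auto
    ultimately show "\<exists>A'. approximable M G A' \<and> measure M (sym_diff (\<Union>i. A i) A') < e"
      using app by metis
  qed auto
  then show "(\<Union>i. A i) \<in> {A. approximable M G A}" by simp
qed

text \<open>The event is approximated by \<open>a + d < X n\<close> instead of
  \<open>a < X n\<close>: on \<open>Z = a\<close>, which may have positive measure,
  \<open>X n\<close> could approach \<open>a\<close> from above. The shift costs only the strip
  \<open>a < Z \<le> a + 2 * d\<close>, which is small for small \<open>d\<close>.\<close>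

lemma (in finite_measure) approximable_greater:
  fixes X :: "nat \<Rightarrow> 'a \<Rightarrow> real"
  assumes G: "\<And>n. sets (G n) \<subseteq> sets M" "\<And>n. space (G n) = space M"
    and X: "\<And>n. X n \<in> borel_measurable (G n)" and [measurable]: "Z \<in> borel_measurable M"
    and lim: "\<And>\<omega>. \<omega> \<in> space M \<Longrightarrow> (\<lambda>n. X n \<omega>) \<longlonglongrightarrow> Z \<omega>"
  shows "approximable M G {\<omega>\<in>space M. a < Z \<omega>}"
  unfolding approximable_def
proof (intro conjI allI impI)
  let ?A = "{\<omega>\<in>space M. a < Z \<omega>}"
  show "?A \<in> sets M" by measurable
  have [measurable]: "X n \<in> borel_measurable M" for n
    using X[of n] G by (auto simp: measurable_def)
  fix e :: real assume e: "0 < e"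
  let ?H = "\<lambda>d. {\<omega>\<in>space M. a < Z \<omega> \<and> Z \<omega> \<le> a + 2 * d}"
  have "(\<lambda>k. measure M (?H (1 / Suc k))) \<longlonglongrightarrow> 0"
  proof (rule measure_tendsto_0_of_eventually_notin)
    fix \<omega>
    show "\<forall>\<^sub>F k in sequentially. \<omega> \<notin> ?H (1 / Suc k)"
    proof (cases "a < Z \<omega>")
      case True
      then have "\<forall>\<^sub>F k in sequentially. inverse (real (Suc k)) < (Z \<omega> - a) / 2"
        by (intro order_tendstoD(2)[OF LIMSEQ_inverse_real_of_nat]) simp
      then show ?thesis by eventually_elim (auto simp: inverse_eq_divide)
    qed auto
  qed auto
  from order_tendstoD(2)[OF this, of "e / 2"] e obtain k where k: "measure M (?H (1 / Suc k)) < e / 2"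
    by (auto simp: eventually_sequentially)
  define d where "d = 1 / real (Suc k)"
  have d: "0 < d" by (simp add: d_def)
  let ?E = "\<lambda>n. {\<omega>\<in>space M. d \<le> \<bar>X n \<omega> - Z \<omega>\<bar>}"
  have "(\<lambda>n. measure M (?E n)) \<longlonglongrightarrow> 0"
  proof (rule measure_tendsto_0_of_eventually_notin)
    fix \<omega> assume "\<omega> \<in> space M"
    from tendstoD[OF lim[OF this] d] show "\<forall>\<^sub>F n in sequentially. \<omega> \<notin> ?E n"
      by eventually_elim (auto simp: dist_real_def)
  qed auto
  from order_tendstoD(2)[OF this, of "e / 2"] e
  have "\<forall>\<^sub>F n in sequentially. measure M (?E n) < e / 2" by simp
  then show "\<forall>\<^sub>F n in sequentially. \<exists>S\<in>sets (G n). measure M (sym_diff ?A S) < e"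
  proof eventually_elim
    case (elim n)
    let ?S = "{\<omega>\<in>space M. a + d < X n \<omega>}"
    have S: "?S \<in> sets (G n)"
      using X[of n] G(2)[of n] by (metis (no_types) borel_measurable_iff_greater)
    \<comment> \<open>If \<open>a < Z\<close> but \<open>X n \<le> a + d\<close>, then
      \<open>Z\<close> lies in the strip or exceeds \<open>X n\<close> by more than
      \<open>d\<close>. If \<open>Z \<le> a\<close> but \<open>a + d < X n\<close>, then
      \<open>X n\<close> exceeds \<open>Z\<close> by more than \<open>d\<close>.\<close>
    have "measure M (sym_diff ?A ?S) \<le> measure M (?H d \<union> ?E n)"
      by (rule finite_measure_mono) auto
    also have "\<dots> \<le> measure M (?H d) + measure M (?E n)"
      by (rule measure_Un_le) auto
    also have "\<dots> < e" using k elim by (simp add: d_def)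
    finally show ?case using S by blast
  qed
qed

section \<open>Continuity of mutual information\<close>

text \<open>Only \<open>c' = 0\<close> is delicate, as \<open>ln\<close> is unbounded near 0. There
  \<open>p n \<le> c n\<close> bounds the product by \<open>\<bar>c n * ln (c n)\<bar>\<close>,
  which tends to 0.\<close>

lemma tendsto_mult_ln:
  fixes p c :: "nat \<Rightarrow> real"
  assumes p: "p \<longlonglongrightarrow> p'" and c: "c \<longlonglongrightarrow> c'" and le: "\<And>n. 0 \<le> p n" "\<And>n. p n \<le> c n"
  shows "(\<lambda>n. p n * ln (c n)) \<longlonglongrightarrow> p' * ln c'"
proof (cases "c' = 0")
  case False
  then show ?thesis by (intro tendsto_intros p c) auto
next
  case True
  have c0: "0 \<le> c n" for n using le order_trans by blast
  have "((\<lambda>x :: real. x * ln x) \<longlongrightarrow> 0) (at_right 0)" by real_asymp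
  then have "((\<lambda>x :: real. x * ln x) \<longlongrightarrow> 0) (at 0 within {0..})"
    by (simp add: at_within_Ici_at_right)
  \<comment> \<open>Continuity at 0, and not only the limit there, allows \<open>c n\<close> itself
    to be 0.\<close>
  then have "continuous (at 0 within {0..}) (\<lambda>x :: real. x * ln x)"
    by (simp add: continuous_within)
  from continuous_within_tendsto_compose'[OF this _ c[unfolded True]] c0
  have "(\<lambda>n. c n * ln (c n)) \<longlonglongrightarrow> 0" by simp
  from tendsto_norm_zero[OF this] have "(\<lambda>n. p n * ln (c n)) \<longlonglongrightarrow> 0"
  proof (rule Lim_null_comparison[rotated])
    show "\<forall>\<^sub>F n in sequentially. norm (p n * ln (c n)) \<le> norm (c n * ln (c n))"
      using le c0 by (auto simp: abs_mult mult_right_mono)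
  qed
  \<comment> \<open>The claimed limit is 0 because \<open>ln 0 = 0\<close>.\<close>
  with True show ?thesis by simp
qed

text \<open>Splits a summand into products whose factor in front is at most the argument of the
  logarithm, the shape of \<open>tendsto_mult_ln\<close>. For \<open>p = 0\<close> everything
  vanishes, even if \<open>a\<close> or \<open>c\<close> is 0.\<close>

lemma mult_ln_divide_eq:
  fixes p a c :: real
  assumes "0 \<le> p" "p \<le> a" "p \<le> c"
  shows "p * ln (p / (a * c)) = p * ln p - p * ln a - p * ln c"
proof (cases "p = 0")
  case False
  then have "0 < p" "0 < a" "0 < c" using assms by auto
  then show ?thesis by (simp add: ln_div ln_mult algebra_simps)
qed simp

text \<open>The measure is 1-Lipschitz for the pseudo-metric.\<close>

lemma (in finite_measure) measure_tendsto_of_sym_diff: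
  assumes "A \<in> sets M" "\<And>n. S n \<in> sets M" and lim: "(\<lambda>n. measure M (sym_diff A (S n))) \<longlonglongrightarrow> 0"
  shows "(\<lambda>n. measure M (S n)) \<longlonglongrightarrow> measure M A"
proof (rule LIM_zero_cancel, rule Lim_null_comparison[OF _ lim])
  have "\<bar>measure M A - measure M (S n)\<bar> \<le> measure M (sym_diff A (S n))" for n
  proof -
    have "measure M A \<le> measure M (S n \<union> sym_diff A (S n))"
      "measure M (S n) \<le> measure M (A \<union> sym_diff A (S n))"
      using assms by (auto intro!: finite_measure_mono)
    moreover have "measure M (S n \<union> sym_diff A (S n)) \<le> measure M (S n) + measure M (sym_diff A (S n))"
      "measure M (A \<union> sym_diff A (S n)) \<le> measure M A + measure M (sym_diff A (S n))"
      using assms by (auto intro!: measure_Un_le)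
    ultimately show ?thesis by linarith
  qed
  then show "\<forall>\<^sub>F n in sequentially. norm (measure M (S n) - measure M A) \<le> measure M (sym_diff A (S n))"
    by (simp add: abs_minus_commute)
qed

definition info_term :: "'a measure \<Rightarrow> 'a set \<Rightarrow> 'a set \<Rightarrow> real" where
  "info_term P A B = measure P (A \<inter> B) * ln (measure P (A \<inter> B) / (measure P A * measure P B))"

text \<open>Lets empty blocks enter or leave the sum, which matters because
  \<open>partition_on\<close> forbids them.\<close>

lemma info_term_empty [simp]: "info_term P A {} = 0"
  by (simp add: info_term_def)

lemma (in finite_measure) info_term_tendsto:
  assumes A [measurable]: "A \<in> sets M" and B [measurable]: "B \<in> sets M"
    and S [measurable]: "\<And>n. S n \<in> sets M"
    and lim: "(\<lambda>n. measure M (sym_diff B (S n))) \<longlonglongrightarrow> 0"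
  shows "(\<lambda>n. info_term M A (S n)) \<longlonglongrightarrow> info_term M A B"
proof -
  have eq: "info_term M A C = measure M (A \<inter> C) * ln (measure M (A \<inter> C))
      - measure M (A \<inter> C) * ln (measure M A) - measure M (A \<inter> C) * ln (measure M C)"
    if "C \<in> sets M" for C
    unfolding info_term_def using that
    by (intro mult_ln_divide_eq finite_measure_mono) auto
  \<comment> \<open>Intersecting both events with \<open>A\<close> can only shrink their symmetric
    difference.\<close>
  have "(\<lambda>n. measure M (sym_diff (A \<inter> B) (A \<inter> S n))) \<longlonglongrightarrow> 0"
    by (rule tendsto_sandwich[OF _ _ tendsto_const lim]) (auto intro!: always_eventually finite_measure_mono)
  then have AB: "(\<lambda>n. measure M (A \<inter> S n)) \<longlonglongrightarrow> measure M (A \<inter> B)"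
    by (intro measure_tendsto_of_sym_diff) auto
  show ?thesis
    unfolding eq[OF B] eq[OF S]
    by (intro tendsto_diff tendsto_mult_ln tendsto_mult_right AB measure_tendsto_of_sym_diff lim
        finite_measure_mono) auto
qed

text \<open>
  Disjointifying approximants of the blocks, and adding the leftover \<open>C k\<close> (which approximates
  the empty set), turns them into a partition again.
\<close>

lemma (in finite_measure) info_sum_approx:
  assumes G: "\<And>n. sets (G n) \<subseteq> sets M" "\<And>n. space (G n) = space M"
    and \<xi>: "finite \<xi>" "\<xi> \<subseteq> sets M"
    and \<zeta>: "finite \<zeta>" "partition_on (space M) \<zeta>" "\<And>B. B \<in> \<zeta> \<Longrightarrow> approximable M G B"
  obtains \<zeta>' where "\<And>n. \<zeta>' n \<in> finite_partitions_in (G n)"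
    "(\<lambda>n. \<Sum>A\<in>\<xi>. \<Sum>B\<in>\<zeta>' n. info_term M A B) \<longlonglongrightarrow> (\<Sum>A\<in>\<xi>. \<Sum>B\<in>\<zeta>. info_term M A B)"
proof -
  define k where "k = card \<zeta>"
  obtain b where b: "bij_betw b {..<k} \<zeta>"
    using ex_bij_betw_nat_finite[OF \<zeta>(1)] by (auto simp: k_def atLeast0LessThan)
  have b_in: "b i \<in> \<zeta>" if "i < k" for i using b that by (auto simp: bij_betw_def)
  have b_sets: "b i \<in> sets M" if "i < k" for i
    using \<zeta>(3)[OF b_in[OF that]] by (auto simp: approximable_def)
  have "\<exists>S. (\<forall>n. S n \<in> sets (G n)) \<and> (\<lambda>n. measure M (sym_diff (b i) (S n))) \<longlonglongrightarrow> 0"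
    if i: "i \<in> {..<k}" for i
  proof -
    from i have "approximable M G (b i)" by (simp add: \<zeta>(3) b_in)
    then show ?thesis by (rule approximable_sequence) blast
  qed
  then have "\<exists>S. \<forall>i\<in>{..<k}. (\<forall>n. S i n \<in> sets (G n)) \<and>
      (\<lambda>n. measure M (sym_diff (b i) (S i n))) \<longlonglongrightarrow> 0"
    by (intro bchoice ballI)
  then obtain S where S: "\<And>i n. i < k \<Longrightarrow> S i n \<in> sets (G n)"
    "\<And>i. i < k \<Longrightarrow> (\<lambda>n. measure M (sym_diff (b i) (S i n))) \<longlonglongrightarrow> 0"
    by auto
  \<comment> \<open>With the whole space at index \<open>k\<close>, the leftover becomes the block
    \<open>C k\<close>, and one formula covers all blocks. Correspondingly, \<open>D k\<close> is
    empty.\<close>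
  define R where "R i n = (if i < k then S i n else space M)" for i n
  define C where "C i n = R i n - (\<Union>j<i. S j n)" for i n
  define D where "D i = (if i < k then b i else {})" for i
  have R: "R i n \<in> sets (G n)" for i n
    using S(1) sets.top[of "G n"] G(2)[of n] by (auto simp: R_def)
  have C: "C i n \<in> sets (G n)" if "i \<le> k" for i n
    unfolding C_def using that S(1) by (intro sets.Diff R sets.finite_UN) auto
  have C_M: "C i n \<in> sets M" if "i \<le> k" for i n using C[OF that] G(1) by blast
  have S_M: "S i n \<in> sets M" if "i < k" for i n using S(1)[OF that] G(1) by blast
  have b_disj: "b i \<inter> b j = {}" if "i < k" "j < k" "i \<noteq> j" for i j
  proof -
    have "b i \<noteq> b j" using b that by (auto simp: bij_betw_def inj_on_def)
    then show ?thesis using partition_onD2[OF \<zeta>(2)] b_in that by (auto dest: disjointD)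
  qed
  have b_cover: "(\<Union>j<k. b j) = space M"
    using \<zeta>(2) b by (auto simp: partition_on_def bij_betw_def)
  have D_lim: "(\<lambda>n. measure M (sym_diff (D i) (C i n))) \<longlonglongrightarrow> 0" if i: "i \<le> k" for i
  proof -
    \<comment> \<open>A point misplaced by \<open>C i\<close> is misplaced by some
      \<open>S j\<close>. If it lies in \<open>b i\<close> but was removed by an earlier
      \<open>S j\<close>, disjointness puts it outside \<open>b j\<close>. If it is left over, it
      belongs to some \<open>b j\<close> but not to \<open>S j\<close>.\<close>
    have sub: "sym_diff (D i) (C i n) \<subseteq> (\<Union>j\<in>{..i} \<inter> {..<k}. sym_diff (b j) (S j n))" for n
    proof
      fix \<omega> assume \<omega>: "\<omega> \<in> sym_diff (D i) (C i n)"
      show "\<omega> \<in> (\<Union>j\<in>{..i} \<inter> {..<k}. sym_diff (b j) (S j n))"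
      proof (cases "i < k")
        case True
        then consider "\<omega> \<in> sym_diff (b i) (S i n)" | j where "j < i" "\<omega> \<in> b i" "\<omega> \<in> S j n"
          using \<omega> by (auto simp: C_def D_def R_def)
        then show ?thesis
        proof cases
          case 2
          with True b_disj[of i j] have "\<omega> \<in> sym_diff (b j) (S j n)" by auto
          with 2 True show ?thesis by (intro UN_I[of j]) auto
        qed (use True in auto)
      next
        case False
        with i \<omega> have "\<omega> \<in> space M" "\<omega> \<notin> (\<Union>j<k. S j n)" "i = k"
          by (auto simp: C_def D_def R_def)
        moreover from this b_cover obtain j where "j < k" "\<omega> \<in> b j" by blast
        ultimately show ?thesis by (intro UN_I[of j]) auto
      qed
    qed
    have sets: "sym_diff (b j) (S j n) \<in> sets M" if "j < k" for j n
      using S_M[OF that] b_sets[OF that] by auto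
    have le: "measure M (sym_diff (D i) (C i n)) \<le> (\<Sum>j\<in>{..i} \<inter> {..<k}. measure M (sym_diff (b j) (S j n)))" for n
      by (rule order_trans[OF finite_measure_mono[OF sub] measure_UNION_le])
        (use sets in auto)
    have "(\<lambda>n. \<Sum>j\<in>{..i} \<inter> {..<k}. measure M (sym_diff (b j) (S j n))) \<longlonglongrightarrow> 0"
      by (intro tendsto_null_sum S(2)) auto
    then show ?thesis
      by (rule Lim_null_comparison[rotated]) (simp add: le)
  qed
  define \<zeta>' where "\<zeta>' n = (\<lambda>i. C i n) ` {..k} - {{}}" for n
  have C_disj: "C i n \<inter> C j n = {}" if "i < j" "j \<le> k" for i j n
    using that by (auto simp: C_def R_def)
  have C_disj': "C i n \<inter> C j n = {}" if "i \<noteq> j" "i \<le> k" "j \<le> k" for i j n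
    using C_disj[of i j] C_disj[of j i] that by (cases "i < j") auto
  have C_cover: "(\<Union>i\<le>k. C i n) = space M" for n
  proof
    show "(\<Union>i\<le>k. C i n) \<subseteq> space M" using C_M sets.sets_into_space by blast
    show "space M \<subseteq> (\<Union>i\<le>k. C i n)"
    proof
      fix \<omega> assume \<omega>: "\<omega> \<in> space M"
      then have "\<omega> \<in> R k n" by (simp add: R_def)
      \<comment> \<open>The first set containing the point decides its block; \<open>R k\<close>
        guarantees that there is one.\<close>
      define i where "i = (LEAST i. \<omega> \<in> R i n)"
      have i: "\<omega> \<in> R i n" "i \<le> k" "\<And>j. j < i \<Longrightarrow> \<omega> \<notin> R j n"
        using \<open>\<omega> \<in> R k n\<close> unfolding i_def by (auto intro: LeastI Least_le dest: not_less_Least)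
      then have "\<omega> \<in> C i n" by (fastforce simp: C_def R_def)
      with i show "\<omega> \<in> (\<Union>i\<le>k. C i n)" by blast
    qed
  qed
  have part: "\<zeta>' n \<in> finite_partitions_in (G n)" for n
    unfolding finite_partitions_in_def
  proof (intro CollectI conjI)
    show "partition_on (space (G n)) (\<zeta>' n)"
    proof (rule partition_onI)
      show "\<Union> (\<zeta>' n) = space (G n)"
        using C_cover[of n] by (fastforce simp: \<zeta>'_def G(2))
      show "disjnt p q" if "p \<in> \<zeta>' n" "q \<in> \<zeta>' n" "p \<noteq> q" for p q
      proof -
        from that obtain i j where "p = C i n" "q = C j n" "i \<le> k" "j \<le> k"
          by (auto simp: \<zeta>'_def)
        with that(3) C_disj'[of i j n] show ?thesis by (auto simp: disjnt_def)
      qed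
    qed (auto simp: \<zeta>'_def)
  qed (use C in \<open>auto simp: \<zeta>'_def\<close>)
  \<comment> \<open>Indexing by \<open>i\<close> may repeat a block, but disjoint blocks that
    coincide are empty and contribute 0.\<close>
  have sum_C: "(\<Sum>B\<in>\<zeta>' n. info_term M A B) = (\<Sum>i\<le>k. info_term M A (C i n))" for A n
  proof -
    have "(\<Sum>B\<in>\<zeta>' n. info_term M A B) = (\<Sum>B\<in>(\<lambda>i. C i n) ` {..k}. info_term M A B)"
      unfolding \<zeta>'_def by (rule sum.mono_neutral_left) auto
    also have "\<dots> = (\<Sum>i\<le>k. info_term M A (C i n))"
    proof (subst sum.reindex_nontrivial)
      fix i j assume "i \<in> {..k}" "j \<in> {..k}" "i \<noteq> j" "C i n = C j n"
      with C_disj'[of i j n] have "C i n = {}" by auto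
      then show "info_term M A (C i n) = 0" by simp
    qed auto
    finally show ?thesis .
  qed
  have sum_D: "(\<Sum>B\<in>\<zeta>. info_term M A B) = (\<Sum>i\<le>k. info_term M A (D i))" for A
    by (simp add: sum.reindex_bij_betw[OF b, symmetric] lessThan_Suc_atMost[symmetric] D_def)
  have "(\<lambda>n. \<Sum>A\<in>\<xi>. \<Sum>B\<in>\<zeta>' n. info_term M A B) \<longlonglongrightarrow> (\<Sum>A\<in>\<xi>. \<Sum>B\<in>\<zeta>. info_term M A B)"
    unfolding sum_C sum_D
    by (intro tendsto_sum info_term_tendsto D_lim) (use \<xi> C_M b_sets in \<open>auto simp: D_def\<close>)
  with part that show thesis by blast
qed

text \<open>Upper bound: a smaller sigma-algebra has fewer partitions. Lower bound: a pair of
  partitions whose sum exceeds \<open>a\<close> is fixed, and the sums of its approximations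
  eventually exceed \<open>a\<close> as well. Arguing with bounds \<open>a\<close> also covers an
  infinite limit.\<close>

lemma (in finite_measure) general_mutual_info_tendsto:
  assumes X: "X \<in> M \<rightarrow>\<^sub>M S" and Z: "\<And>n. Z n \<in> M \<rightarrow>\<^sub>M V n"
    and mono: "\<And>n. sets (vimage_algebra (space M) (Z n) (V n)) \<subseteq> sets (vimage_algebra (space M) W U)"
    and app: "\<And>A. A \<in> sets (vimage_algebra (space M) W U) \<Longrightarrow>
      approximable M (\<lambda>n. vimage_algebra (space M) (Z n) (V n)) A"
  shows "(\<lambda>n. general_mutual_info M S X (V n) (Z n)) \<longlonglongrightarrow> general_mutual_info M S X U W"
proof -
  let ?G = "\<lambda>n. vimage_algebra (space M) (Z n) (V n)"
  let ?K = "vimage_algebra (space M) W U" and ?L = "vimage_algebra (space M) X S"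
  let ?s = "\<lambda>(\<xi>, \<zeta>). ereal (\<Sum>A\<in>\<xi>. \<Sum>B\<in>\<zeta>. info_term M A B)"
  have eq: "general_mutual_info M S X U' Z' =
      (SUP p \<in> finite_partitions_in ?L \<times> finite_partitions_in (vimage_algebra (space M) Z' U'). ?s p)"
    for U' :: "'x measure" and Z'
    by (simp add: general_mutual_info_def info_term_def)
  have G: "sets (?G n) \<subseteq> sets M" for n
    by (intro sets_image_in_sets Z) simp
  have L: "sets ?L \<subseteq> sets M"
    by (intro sets_image_in_sets X) simp
  show ?thesis
  proof (rule order_tendstoI)
    fix a assume a: "general_mutual_info M S X U W < a"
    have "general_mutual_info M S X (V n) (Z n) \<le> general_mutual_info M S X U W" for n
      unfolding eq using mono[of n]
      by (intro SUP_subset_mono) (auto simp: finite_partitions_in_def)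
    from this a show "\<forall>\<^sub>F n in sequentially. general_mutual_info M S X (V n) (Z n) < a"
      by (intro always_eventually allI) (rule order.strict_trans1)
  next
    fix a assume "a < general_mutual_info M S X U W"
    then obtain \<xi> \<zeta> where \<xi>: "\<xi> \<in> finite_partitions_in ?L" and \<zeta>: "\<zeta> \<in> finite_partitions_in ?K"
      and a: "a < ?s (\<xi>, \<zeta>)"
      unfolding eq less_SUP_iff by blast
    obtain \<zeta>' where \<zeta>': "\<And>n. \<zeta>' n \<in> finite_partitions_in (?G n)"
      and lim: "(\<lambda>n. \<Sum>A\<in>\<xi>. \<Sum>B\<in>\<zeta>' n. info_term M A B) \<longlonglongrightarrow> (\<Sum>A\<in>\<xi>. \<Sum>B\<in>\<zeta>. info_term M A B)"
    proof (rule info_sum_approx[of ?G \<xi> \<zeta>])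
      show "approximable M ?G B" if "B \<in> \<zeta>" for B
        using app \<zeta> that by (auto simp: finite_partitions_in_def)
    qed (use G L \<xi> \<zeta> in \<open>auto simp: finite_partitions_in_def\<close>)
    from lim have "(\<lambda>n. ?s (\<xi>, \<zeta>' n)) \<longlonglongrightarrow> ?s (\<xi>, \<zeta>)" by (simp only: prod.case lim_ereal)
    from order_tendstoD(1)[OF this a]
    show "\<forall>\<^sub>F n in sequentially. a < general_mutual_info M S X (V n) (Z n)"
    proof eventually_elim
      case (elim n)
      also have "?s (\<xi>, \<zeta>' n) \<le> general_mutual_info M S X (V n) (Z n)"
        unfolding eq using \<xi> \<zeta>'[of n] by (intro SUP_upper) auto
      finally show ?case .
    qed
  qed
qed

section \<open>Sampling a continuous process\<close>

lemma sampling_times_in: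
  assumes "sampling_times T n \<tau>" "i \<le> n"
  shows "\<tau> i \<in> {0..T}"
proof -
  have mono: "\<tau> i \<le> \<tau> j" if "i \<le> j" "j \<le> n" for i j
    using that(1,2)
  proof (induction j rule: dec_induct)
    case (step j)
    then have "\<tau> i \<le> \<tau> j" "\<tau> j < \<tau> (Suc j)"
      using assms(1) by (auto simp: sampling_times_def)
    then show ?case by simp
  qed simp
  from mono[of 0 i] mono[of i n] assms show ?thesis by (auto simp: sampling_times_def)
qed

text \<open>Take the first sampling time at or after \<open>r\<close>. Its predecessor lies before
  \<open>r\<close>, so \<open>r\<close> is within one gap of it.\<close>

lemma sampling_times_near:
  assumes \<tau>: "sampling_times T n \<tau>" and n: "n \<ge> 1" and r: "r \<in> {0..T}"
  obtains i where "i \<le> n" "\<bar>\<tau> i - r\<bar> \<le> mesh n \<tau>"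
proof -
  define i where "i = (LEAST i. r \<le> \<tau> i)"
  have "r \<le> \<tau> n" using \<tau> r by (auto simp: sampling_times_def)
  then have i: "r \<le> \<tau> i" "i \<le> n" "\<And>j. j < i \<Longrightarrow> \<tau> j < r"
    unfolding i_def by (auto intro: LeastI Least_le dest: not_less_Least)
  have diff_le: "\<tau> j - \<tau> (j - 1) \<le> mesh n \<tau>" if "j \<in> {1..n}" for j
    unfolding mesh_def using that by (intro Max_ge) auto
  show thesis
  proof (cases "i = 0")
    case True
    then have "\<tau> i = r" using i(1) r \<tau> by (auto simp: sampling_times_def)
    \<comment> \<open>Index 0 has no predecessor, but then \<open>r = 0\<close> is itself a sampling
      time, and the first gap shows that the mesh is nonnegative.\<close>
    moreover have "0 \<le> mesh n \<tau>"
      using diff_le[of 1] n \<tau> by (force simp: sampling_times_def)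
    ultimately show thesis using that[of i] i by simp
  next
    case False
    with i have "\<tau> (i - 1) < r" by simp
    moreover have "\<tau> i - \<tau> (i - 1) \<le> mesh n \<tau>" using False i by (intro diff_le) auto
    ultimately show thesis using i that[of i] by simp
  qed
qed

lemma path_of_in_path_space:
  assumes "continuous_on {0..T} (\<lambda>t. Y t \<omega>)"
  shows "path_of T Y \<omega> \<in> space (path_space T)"
  using assms by (auto simp: path_of_def path_space_def space_restrict_space space_PiM
      cong: continuous_on_cong_simp)

text \<open>The sigma-algebra of \<open>path_space\<close> is generated by the coordinates.
  \<open>N\<close> is left general so that it can later consist of the approximable events.\<close>

lemma measurable_path_ofI:
  assumes "\<And>t. t \<in> {0..T} \<Longrightarrow> Y t \<in> borel_measurable N"
    and "\<And>\<omega>. \<omega> \<in> space N \<Longrightarrow> continuous_on {0..T} (\<lambda>t. Y t \<omega>)"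
  shows "path_of T Y \<in> N \<rightarrow>\<^sub>M path_space T"
  unfolding path_space_def
proof (rule measurable_restrict_space2)
  show "path_of T Y \<in> space N \<rightarrow> {\<phi>. continuous_on {0..T} \<phi>}"
    using assms(2) by (auto simp: path_of_def cong: continuous_on_cong_simp)
  show "path_of T Y \<in> N \<rightarrow>\<^sub>M Pi\<^sub>M {0..T} (\<lambda>_. borel)"
    unfolding path_of_def[abs_def] using assms(1) by (intro measurable_restrict) auto
qed

lemma (in finite_measure) sampled_mutual_info_tendsto:
  assumes X: "X \<in> M \<rightarrow>\<^sub>M count_space \<M>"
    and Y: "\<And>t. t \<in> {0..T} \<Longrightarrow> Y t \<in> borel_measurable M"
    and cont: "\<And>\<omega>. \<omega> \<in> space M \<Longrightarrow> continuous_on {0..T} (\<lambda>t. Y t \<omega>)"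
    and \<tau>: "\<And>n. n \<ge> 1 \<Longrightarrow> sampling_times T n (\<tau> n)"
    and mesh: "(\<lambda>n. mesh n (\<tau> n)) \<longlonglongrightarrow> 0"
  shows "(\<lambda>n. sampled_mutual_info M \<M> X Y n (\<tau> n)) \<longlonglongrightarrow> path_mutual_info M \<M> X Y T"
proof -
  \<comment> \<open>The index is shifted because grids are given only for \<open>n \<ge> 1\<close>;
    \<open>LIMSEQ_imp_Suc\<close> undoes the shift at the end.\<close>
  let ?Z = "\<lambda>n. sampled (Suc n) (\<tau> (Suc n)) Y"
  let ?V = "\<lambda>n. Pi\<^sub>M {0..Suc n} (\<lambda>_. borel :: real measure)"
  let ?G = "\<lambda>n. vimage_algebra (space M) (?Z n) (?V n)"
  let ?K = "vimage_algebra (space M) (path_of T Y) (path_space T)"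
  have in_T: "\<tau> (Suc n) i \<in> {0..T}" if "i \<le> Suc n" for n i
    using sampling_times_in[OF \<tau>[of "Suc n"] that] by simp
  \<comment> \<open>Used with \<open>N = M\<close> for measurability, and with \<open>N = ?K\<close>
    to see that the samples carry no more events than the path.\<close>
  have Z: "?Z n \<in> N \<rightarrow>\<^sub>M ?V n" if "\<And>t. t \<in> {0..T} \<Longrightarrow> Y t \<in> borel_measurable N" for n N
    unfolding sampled_def[abs_def] using in_T that by (intro measurable_restrict) auto
  have G: "sets (?G n) \<subseteq> sets M" for n
    by (intro sets_image_in_sets Z Y) simp
  have pathK: "path_of T Y \<in> ?K \<rightarrow>\<^sub>M path_space T"
    using path_of_in_path_space[OF cont] by (intro measurable_vimage_algebra1) auto
  have YK: "Y t \<in> borel_measurable ?K" if t: "t \<in> {0..T}" for t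
  proof -
    have "(\<lambda>\<phi>. \<phi> t) \<in> borel_measurable (path_space T)"
      unfolding path_space_def using t
      by (intro measurable_restrict_space1 measurable_component_singleton)
    from measurable_compose[OF pathK this] show ?thesis
      using t by (simp add: path_of_def)
  qed
  have YG: "Y (\<tau> (Suc n) i) \<in> borel_measurable (?G n)" if i: "i \<le> Suc n" for n i
  proof -
    have "?Z n \<in> ?G n \<rightarrow>\<^sub>M ?V n"
      by (intro measurable_vimage_algebra1) (auto simp: sampled_def space_PiM)
    moreover have "(\<lambda>x. x i) \<in> borel_measurable (?V n)"
      using i by (intro measurable_component_singleton) auto
    ultimately have "(\<lambda>\<omega>. ?Z n \<omega> i) \<in> borel_measurable (?G n)"
      by (rule measurable_compose)
    then show ?thesis using i by (simp add: sampled_def)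
  qed
  \<comment> \<open>In each grid choose a time within one mesh of \<open>r\<close>; by continuity,
    the samples there converge to \<open>Y r\<close>.\<close>
  have greater: "approximable M ?G {\<omega>\<in>space M. a < Y r \<omega>}" if r: "r \<in> {0..T}" for r a
  proof -
    have "\<exists>i\<le>Suc n. \<bar>\<tau> (Suc n) i - r\<bar> \<le> mesh (Suc n) (\<tau> (Suc n))" for n
      using sampling_times_near[OF \<tau> _ r, of "Suc n"] by (metis le_add1 plus_1_eq_Suc)
    then obtain i where i: "\<And>n. i n \<le> Suc n"
      "\<And>n. \<bar>\<tau> (Suc n) (i n) - r\<bar> \<le> mesh (Suc n) (\<tau> (Suc n))"
      by metis
    have lim: "(\<lambda>n. \<tau> (Suc n) (i n)) \<longlonglongrightarrow> r"
      by (rule LIM_zero_cancel, rule Lim_null_comparison[OF _ LIMSEQ_Suc[OF mesh]])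
        (simp add: i)
    have "(\<lambda>n. Y (\<tau> (Suc n) (i n)) \<omega>) \<longlonglongrightarrow> Y r \<omega>" if "\<omega> \<in> space M" for \<omega>
      by (rule continuous_on_tendsto_compose[OF cont[OF that] lim r])
        (intro always_eventually allI in_T i(1))
    then show ?thesis
      by (intro approximable_greater[where X = "\<lambda>n. Y (\<tau> (Suc n) (i n))", OF G _ YG[OF i(1)] Y[OF r]])
        simp_all
  qed
  have "(\<lambda>n. general_mutual_info M (count_space \<M>) X (?V n) (?Z n))
    \<longlonglongrightarrow> general_mutual_info M (count_space \<M>) X (path_space T) (path_of T Y)"
  proof (rule general_mutual_info_tendsto[OF X])
    show "?Z n \<in> M \<rightarrow>\<^sub>M ?V n" for n by (intro Z Y)
    show "sets (?G n) \<subseteq> sets ?K" for n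
      by (intro sets_image_in_sets Z YK) simp
    fix A assume A: "A \<in> sets ?K"
    interpret app: sigma_algebra "space M" "{A. approximable M ?G A}"
      by (intro sigma_algebra_approximable G) simp
    \<comment> \<open>A measurable space whose events are the approximable ones; the measure 0 is a
      dummy. Measurability of the path map into \<open>path_space\<close> from \<open>?N\<close>
      says that every path event is approximable.\<close>
    let ?N = "measure_of (space M) {A. approximable M ?G A} (\<lambda>_. 0)"
    have N: "space ?N = space M" "sets ?N = {A. approximable M ?G A}"
      using app.space_closed by auto
    have "path_of T Y \<in> ?N \<rightarrow>\<^sub>M path_space T"
      using greater cont by (intro measurable_path_ofI) (auto simp: borel_measurable_iff_greater N)
    from sets_image_in_sets[OF N(1) this] A show "approximable M ?G A"
      by (auto simp: N)
  qed
  then have "(\<lambda>n. sampled_mutual_info M \<M> X Y (Suc n) (\<tau> (Suc n))) \<longlonglongrightarrow> path_mutual_info M \<M> X Y T"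
    by (simp add: sampled_mutual_info_def path_mutual_info_def)
  then show ?thesis by (rule LIMSEQ_imp_Suc)
qed

text \<open>The generators of the channel filtration are events of \<open>P\<close>: those of
  \<open>M\<close> by measurability, those of \<open>B s\<close> through \<open>F s\<close>, and the
  null sets by definition.\<close>

lemma channel_solution_measurable:
  assumes "usual_filtration P F" "standard_brownian_motion P F B" "M \<in> P \<rightarrow>\<^sub>M count_space \<M>"
    and sol: "channel_solution P B \<M> M g T Y" and t: "t \<in> {0..T}"
  shows "Y t \<in> borel_measurable P"
proof -
  have "B s \<in> borel_measurable P" if "0 \<le> s" for s
  proof (rule measurable_from_subalg)
    show "subalgebra P (F s)" using assms(1) that by (simp add: usual_filtration_def)
    show "B s \<in> borel_measurable (F s)" using assms(2) that by (simp add: standard_brownian_motion_def)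
  qed
  then have "sets (vimage_algebra (space P) (B s) borel) \<subseteq> sets P" if "s \<in> {0..t}" for s
    using that by (intro sets_image_in_sets) auto
  moreover have "sets (vimage_algebra (space P) M (count_space \<M>)) \<subseteq> sets P"
    using assms(3) by (intro sets_image_in_sets) auto
  ultimately have gen: "sets (vimage_algebra (space P) M (count_space \<M>)) \<union>
      (\<Union>s\<in>{0..t}. sets (vimage_algebra (space P) (B s) borel)) \<union> null_sets P \<subseteq> sets P"
    by (intro Un_least UN_least) auto
  then have "sets (channel_filtration P \<M> M B t) \<subseteq> sets P"
    unfolding channel_filtration_def sets_measure_of[OF order_trans[OF gen sets.space_closed]]
    by (intro sets.sigma_sets_subset)
  moreover have "space (channel_filtration P \<M> M B t) = space P"
    by (simp add: channel_filtration_def space_measure_of_conv)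
  moreover have "Y t \<in> borel_measurable (channel_filtration P \<M> M B t)"
    using sol t by (auto simp: channel_solution_def)
  ultimately show ?thesis by (auto simp: measurable_def)
qed

theorem theorem3p2:
  fixes P :: "'a measure" and F :: "real \<Rightarrow> 'a measure" and B Y :: "real \<Rightarrow> 'a \<Rightarrow> real"
    and \<M> :: "'m set" and M :: "'a \<Rightarrow> 'm"
    and g :: "real \<Rightarrow> 'm \<Rightarrow> (real \<Rightarrow> real) \<Rightarrow> real"
    and T :: real and \<tau> :: "nat \<Rightarrow> nat \<Rightarrow> real"
  assumes "0 < T"
    and "prob_space P"
    and "usual_filtration P F"
    and "standard_brownian_motion P F B"
    and "finite \<M>"
    and "M \<in> P \<rightarrow>\<^sub>M count_space \<M>"
    and "prob_space.indep_set P
           (sets (vimage_algebra (space P) M (count_space \<M>)))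
           (sets (vimage_algebra (space P) (\<lambda>\<omega>. \<lambda>t\<in>{0..}. B t \<omega>) (Pi\<^sub>M {0..} (\<lambda>_. borel))))"
    and "(\<lambda>(s, m, \<phi>). g s m \<phi>) \<in> borel_measurable
           (restrict_space borel {0..T} \<Otimes>\<^sub>M (count_space \<M> \<Otimes>\<^sub>M path_space T))"
    and "\<And>n. n \<ge> 1 \<Longrightarrow> sampling_times T n (\<tau> n)"
  shows
    "(unique_channel_solution P B \<M> M g T Y \<and>
      (AE \<omega> in P. (\<integral>\<^sup>+ t\<in>{0..T}. ennreal ((drift g T M Y t \<omega>)\<^sup>2) \<partial>lborel) < \<infinity>) \<and>
      (AE \<omega> in P. (\<integral>\<^sup>+ t\<in>{0..T}. ennreal ((drift g T M B t \<omega>)\<^sup>2) \<partial>lborel) < \<infinity>) \<and>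
      (\<integral>\<^sup>+ t\<in>{0..T}. (\<integral>\<^sup>+ \<omega>. ennreal \<bar>drift g T M Y t \<omega>\<bar> \<partial>P) \<partial>lborel) < \<infinity> \<and>
      (\<forall>n\<ge>1. \<tau> n ` {0..n} \<subseteq> \<tau> (Suc n) ` {0..Suc n}) \<and>
      (\<lambda>n. mesh n (\<tau> n)) \<longlonglongrightarrow> 0
      \<longrightarrow> (\<lambda>n. sampled_mutual_info P \<M> M Y n (\<tau> n)) \<longlonglongrightarrow> path_mutual_info P \<M> M Y T)
     \<and>
     (channel_solution P B \<M> M g T Y \<and>
      (\<exists>L>0. \<forall>s\<^sub>1\<in>{0..T}. \<forall>s\<^sub>2\<in>{0..T}. \<forall>t\<^sub>1\<in>{0..T}. \<forall>t\<^sub>2\<in>{0..T}. \<forall>m\<in>\<M>.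
         \<forall>\<phi>\<in>space (path_space T). \<forall>\<psi>\<in>space (path_space T).
           \<bar>g s\<^sub>1 m (stopped T s\<^sub>2 \<phi>) - g t\<^sub>1 m (stopped T t\<^sub>2 \<psi>)\<bar>
             \<le> L * (\<bar>s\<^sub>1 - t\<^sub>1\<bar> + path_dist T s\<^sub>2 \<phi> t\<^sub>2 \<psi>)) \<and>
      (\<exists>L>0. \<forall>t\<in>{0..T}. \<forall>m\<in>\<M>. \<forall>\<phi>\<in>space (path_space T).
           \<bar>g t m (stopped T t \<phi>)\<bar> \<le> L * (1 + path_norm t \<phi>)) \<and>
      (\<lambda>n. mesh n (\<tau> n)) \<longlonglongrightarrow> 0
      \<longrightarrow> (\<lambda>n. sampled_mutual_info P \<M> M Y n (\<tau> n)) \<longlonglongrightarrow> path_mutual_info P \<M> M Y T)"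
proof -
  interpret prob_space P by fact
  \<comment> \<open>Both parts contain a solution \<open>Y\<close> and a vanishing mesh; being a
    solution makes \<open>Y\<close> measurable with continuous paths.\<close>
  have lim: "(\<lambda>n. sampled_mutual_info P \<M> M Y n (\<tau> n)) \<longlonglongrightarrow> path_mutual_info P \<M> M Y T"
    if "channel_solution P B \<M> M g T Y" "(\<lambda>n. mesh n (\<tau> n)) \<longlonglongrightarrow> 0"
    using that assms(3,4,6,9)
    by (intro sampled_mutual_info_tendsto channel_solution_measurable)
      (auto simp: channel_solution_def)
  then show ?thesis by (auto simp: unique_channel_solution_def)
qed

end
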